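(* Let $X_1,X_2$ be i.i.d. from $P_X$ and, independently, $Y_1,Y_2$ i.i.d. from $P_Y$, distributions on $\mathbb{R}^d$ such that $\beta^\top X_1$ and $\beta^\top Y_1$ have continuous distribution functions for $\lambda$-almost all $\beta\in\mathbb{S}^{d-1}$. Then $$\int_{\mathbb{S}^{d-1}}\Big(\mathbb{P}(\beta^\top X_1>\beta^\top Y_1)-\frac12\Big)^2d\lambda(\beta)=\frac14-\frac1{2\pi}\mathbb{E}\big[\mathsf{Ang}(X_1-Y_1,X_2-Y_2)\big].$$
   Context: $\lambda$ is the uniform probability measure on the unit sphere $\mathbb{S}^{d-1}\subset\mathbb{R}^d$; for nonzero $U_1,U_2\in\mathbb{R}^d$, $\mathsf{Ang}(U_1,U_2)=\arccos\{U_1^\top U_2/(\|U_1\|\|U_2\|)\}$. The left side is the projection-averaging generalization of the Wilcoxon–Mann–Whitney quantity $\mathbb{P}(X>Y)-1/2$. *)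

theory Defs
  imports "HOL-Probability.Probability"
begin

text \<open>
  The uniform distribution on the unit sphere, as a measure whose space is \<open>sphere 0 1\<close>: the law of
  \<open>U / \<parallel>U\<parallel>\<close> for \<open>U\<close> uniform on the unit ball (normalised cone measure). The exceptional value
  \<open>sgn 0 = 0\<close> lies off the sphere and has probability zero. In dimension one this gives mass
  \<open>1/2\<close> to each of the two points. The lemmas below confirm that it is a probability measure
  invariant under the orthogonal group, which characterises it among Borel measures on the sphere.
\<close>

definition uniform_sphere :: "'a::euclidean_space measure" where
  "uniform_sphere =
     restrict_space (distr (uniform_measure lborel (ball 0 1)) borel sgn) (sphere 0 1)"

text \<open>
  Since \<open>x / 0 = 0\<close>, this total function takes the value \<open>pi / 2\<close> if one of the vectors is zero,
  where the angle is undefined.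
\<close>

definition Ang :: "'a::real_inner \<Rightarrow> 'a \<Rightarrow> real" where
  "Ang u v = arccos ((u \<bullet> v) / (norm u * norm v))"

lemma borel_measurable_sgn_euclidean [measurable]:
  "(sgn :: 'a::euclidean_space \<Rightarrow> 'a) \<in> borel_measurable borel"
  unfolding sgn_div_norm by measurable

lemma space_uniform_sphere [simp]: "space uniform_sphere = sphere 0 1"
  by (simp add: uniform_sphere_def space_restrict_space)

lemma sets_uniform_sphere [measurable_cong]:
  "sets uniform_sphere = sets (restrict_space borel (sphere 0 1))"
  by (simp add: uniform_sphere_def sets_restrict_space)

lemma emeasure_uniform_sphere:
  fixes A :: "'a::euclidean_space set"
  assumes "A \<in> sets borel" "A \<subseteq> sphere 0 1"
  shows "emeasure uniform_sphere A =
    emeasure lborel (ball 0 1 \<inter> sgn -` A) / emeasure lborel (ball 0 1 :: 'a set)"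
proof -
  have "sgn -` A \<in> sets (borel :: 'a measure)"
    using measurable_sets[OF borel_measurable_sgn_euclidean assms(1)] by simp
  then show ?thesis
    using assms unfolding uniform_sphere_def
    by (subst emeasure_restrict_space) (auto simp: emeasure_distr)
qed

lemma prob_space_uniform_sphere: "prob_space (uniform_sphere :: 'a::euclidean_space measure)"
proof
  let ?B = "ball 0 1 :: 'a set"
  have "sgn -` sphere 0 1 = - {0 :: 'a}"
    by (auto simp: norm_sgn split: if_splits)
  then have "emeasure lborel (?B \<inter> sgn -` sphere 0 1) = emeasure lborel (?B - {0})"
    by (simp add: Diff_eq)
  also have "\<dots> = emeasure lborel ?B"
    by (subst emeasure_Diff) auto
  finally show "emeasure uniform_sphere (space uniform_sphere :: 'a set) = 1"
    using emeasure_lborel_ball_finite[of "0::'a" 1] content_ball_pos[of 1 "0::'a"]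
    by (subst emeasure_uniform_sphere)
       (auto intro!: ennreal_divide_self simp: measure_def)
qed

lemma distr_lborel_orthogonal_transformation:
  fixes f :: "'a::euclidean_space \<Rightarrow> 'a"
  assumes f: "orthogonal_transformation f"
  shows "distr lborel borel f = lborel"
proof (rule measure_eqI)
  fix A :: "'a set"
  assume "A \<in> sets (distr lborel borel f)"
  then have A [measurable]: "A \<in> sets borel" by simp
  let ?B = "ball 0 1 :: 'a set"
  have [measurable]: "?B \<in> sets borel" by simp
  have lin: "linear f" using f by (rule orthogonal_transformation_linear)
  have [measurable]: "f \<in> borel_measurable borel"
    using lin by (intro borel_measurable_continuous_onI linear_continuous_on linear_linear[THEN iffD2])
  have shift: "(\<integral>\<^sup>+x. g x \<partial>lborel) = (\<integral>\<^sup>+x. g (x + c) \<partial>lborel)"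
    if [measurable]: "g \<in> borel_measurable borel" for g and c :: 'a
    by (subst lborel_distr_plus[of c, symmetric], subst nn_integral_distr) (auto simp: add.commute)
  have shift_f: "(\<integral>\<^sup>+x. g (f x) \<partial>lborel) = (\<integral>\<^sup>+x. g (f x + c) \<partial>lborel)"
    if [measurable]: "g \<in> borel_measurable borel" for g and c :: 'a
  proof -
    obtain b where "c = f b"
      using orthogonal_transformation_surj[OF f] by (metis surjD)
    then show ?thesis
      by (subst shift[of _ b]) (auto simp: linear_add[OF lin])
  qed
  have "emeasure (distr lborel borel f) A * emeasure lborel ?B
      = (\<integral>\<^sup>+x. (\<integral>\<^sup>+y. indicator A (f x) * indicator ?B y \<partial>lborel) \<partial>lborel)"
  proof -
    have "emeasure (distr lborel borel f) A = (\<integral>\<^sup>+x. indicator A (f x) \<partial>lborel)"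
      using nn_integral_distr[of f lborel borel "indicator A"] by simp
    then show ?thesis
      by (simp add: nn_integral_cmult_indicator nn_integral_multc)
  qed
  also have "\<dots> = (\<integral>\<^sup>+x. (\<integral>\<^sup>+y. indicator A (f x) * indicator ?B (y - f x) \<partial>lborel) \<partial>lborel)"
  proof (rule nn_integral_cong)
    fix x :: 'a
    have "(\<lambda>y. indicator A (f x) * indicator ?B y :: ennreal) \<in> borel_measurable borel"
      by measurable
    from shift[OF this, of "- f x"]
    show "(\<integral>\<^sup>+y. indicator A (f x) * indicator ?B y \<partial>lborel)
        = (\<integral>\<^sup>+y. indicator A (f x) * indicator ?B (y - f x) \<partial>lborel)"
      by simp
  qed
  also have "\<dots> = (\<integral>\<^sup>+y. (\<integral>\<^sup>+x. indicator A (f x) * indicator ?B (y - f x) \<partial>lborel) \<partial>lborel)"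
    by (rule lborel_pair.Fubini') measurable
  also have "\<dots> = (\<integral>\<^sup>+y. (\<integral>\<^sup>+x. indicator A (f x + y) * indicator ?B (- f x) \<partial>lborel) \<partial>lborel)"
  proof (rule nn_integral_cong)
    fix y :: 'a
    have "(\<lambda>z. indicator A z * indicator ?B (y - z) :: ennreal) \<in> borel_measurable borel"
      by measurable
    from shift_f[OF this, of y]
    show "(\<integral>\<^sup>+x. indicator A (f x) * indicator ?B (y - f x) \<partial>lborel)
        = (\<integral>\<^sup>+x. indicator A (f x + y) * indicator ?B (- f x) \<partial>lborel)"
      by simp
  qed
  also have "\<dots> = (\<integral>\<^sup>+x. (\<integral>\<^sup>+y. indicator A (f x + y) * indicator ?B (- f x) \<partial>lborel) \<partial>lborel)"
    by (rule lborel_pair.Fubini') simp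
  also have "\<dots> = (\<integral>\<^sup>+x. emeasure lborel A * indicator ?B x \<partial>lborel)"
  proof (rule nn_integral_cong)
    fix x :: 'a
    have "(\<integral>\<^sup>+y. indicator A (f x + y) \<partial>lborel) = emeasure lborel A"
      using shift[of "indicator A" "f x"] by (simp add: add.commute)
    moreover have "indicator ?B (- f x) = (indicator ?B x :: ennreal)"
      by (simp add: indicator_def orthogonal_transformation_norm[OF f])
    ultimately show "(\<integral>\<^sup>+y. indicator A (f x + y) * indicator ?B (- f x) \<partial>lborel)
        = emeasure lborel A * indicator ?B x"
      by (simp add: nn_integral_multc)
  qed
  also have "\<dots> = emeasure lborel A * emeasure lborel ?B"
    by (simp add: nn_integral_cmult)
  finally have eq: "emeasure lborel ?B * emeasure (distr lborel borel f) A
      = emeasure lborel ?B * emeasure lborel A"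
    by (simp add: mult.commute)
  have "emeasure lborel ?B \<noteq> 0"
    using content_ball_pos[of 1 "0::'a"] by (auto simp: measure_def)
  moreover have "emeasure lborel ?B \<noteq> \<top>"
    using emeasure_lborel_ball_finite[of "0::'a" 1] by auto
  ultimately show "emeasure (distr lborel borel f) A = emeasure lborel A"
    using eq by (metis ennreal_mult_cancel_left)
qed simp

lemma uniform_sphere_orthogonal_invariant:
  fixes f :: "'a::euclidean_space \<Rightarrow> 'a"
  assumes f: "orthogonal_transformation f"
  shows "distr uniform_sphere uniform_sphere f = uniform_sphere"
proof (rule measure_eqI)
  fix A :: "'a set"
  assume "A \<in> sets (distr uniform_sphere uniform_sphere f)"
  then have AU: "A \<in> sets uniform_sphere" by simp
  then have A [measurable]: "A \<in> sets borel" and As: "A \<subseteq> sphere 0 1"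
    by (auto simp: sets_uniform_sphere sets_restrict_space)
  let ?B = "ball 0 1 :: 'a set"
  have lin: "linear f" using f by (rule orthogonal_transformation_linear)
  have nf: "norm (f x) = norm x" for x
    using f by (rule orthogonal_transformation_norm)
  have [measurable]: "f \<in> borel_measurable borel"
    using lin by (intro borel_measurable_continuous_onI linear_continuous_on linear_linear[THEN iffD2])
  have fU: "f \<in> measurable uniform_sphere uniform_sphere"
    unfolding measurable_cong_sets[OF sets_uniform_sphere sets_uniform_sphere]
    by (intro measurable_restrict_space3) (auto simp: nf)
  have "f -` A \<subseteq> sphere 0 1"
    using As by (force simp: nf)
  moreover from this have "f -` A \<inter> sphere 0 1 = f -` A" by blast
  moreover have "f -` A \<in> sets borel"
    using measurable_sets[of f borel borel A] by simp
  moreover have "sgn (f x) = f (sgn x)" for x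
    by (simp add: sgn_div_norm nf linear_cmul[OF lin])
  then have "?B \<inter> sgn -` f -` A = f -` (?B \<inter> sgn -` A)"
    by (auto simp: nf)
  moreover have S: "?B \<inter> sgn -` A \<in> sets borel"
    using measurable_sets[OF borel_measurable_sgn_euclidean A] by auto
  have "emeasure lborel (f -` (?B \<inter> sgn -` A)) = emeasure (distr lborel borel f) (?B \<inter> sgn -` A)"
    using S by (simp add: emeasure_distr)
  ultimately show "emeasure (distr uniform_sphere uniform_sphere f) A = emeasure uniform_sphere A"
    using As by (simp add: emeasure_distr[OF fU AU] emeasure_uniform_sphere
        distr_lborel_orthogonal_transformation[OF f])
qed simp

end

theory Submission
  imports Defs
begin

text \<open>
  Write \<open>Z\<^sub>i = X\<^sub>i - Y\<^sub>i\<close>. For almost every \<open>\<beta>\<close> the projection \<open>\<beta> \<bullet> Z\<^sub>1\<close> has no atom at \<open>0\<close>, so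
  \<open>P(\<beta> \<bullet> Z\<^sub>1 > 0) - 1/2 = E(sgn (\<beta> \<bullet> Z\<^sub>1)) / 2\<close>, whose square is
  \<open>E(sgn (\<beta> \<bullet> Z\<^sub>1) * sgn (\<beta> \<bullet> Z\<^sub>2)) / 4\<close> by independence. Exchanging the integrals leaves
  Grothendieck's identity, that the mean of \<open>sgn (\<beta> \<bullet> u) * sgn (\<beta> \<bullet> v)\<close> over the sphere is
  \<open>1 - 2 * Ang u v / pi\<close>. It holds because the measure of the wedge
  \<open>{\<beta>. \<beta> \<bullet> u > 0 \<and> \<beta> \<bullet> v < 0}\<close> is, by rotation invariance, an additive nonnegative function of
  the angle with value \<open>1/2\<close> at \<open>pi\<close>, hence linear.
\<close>

section \<open>Wedges of the sphere and Grothendieck's identity\<close>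

text \<open>The map is rotation by \<open>r\<close> in the span of \<open>e1\<close> and
  \<open>e2\<close> and fixes the orthogonal complement. Writing it as the identity plus a
  correction in the span avoids choosing a basis of the complement.\<close>

lemma orthogonal_transformation_plane_rotation:
  fixes e1 e2 :: "'a::euclidean_space"
  assumes [simp]: "norm e1 = 1" "norm e2 = 1" "e1 \<bullet> e2 = 0"
  shows "orthogonal_transformation (\<lambda>x. x + ((cos r - 1) * (x \<bullet> e1) - sin r * (x \<bullet> e2)) *\<^sub>R e1
           + (sin r * (x \<bullet> e1) + (cos r - 1) * (x \<bullet> e2)) *\<^sub>R e2)"
  unfolding orthogonal_transformation_def
proof (intro conjI allI)
  have [simp]: "e1 \<bullet> e1 = 1" "e2 \<bullet> e2 = 1" "e2 \<bullet> e1 = 0"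
    using assms by (simp_all add: dot_square_norm inner_commute)
  fix v w
  let ?f = "\<lambda>x. x + ((cos r - 1) * (x \<bullet> e1) - sin r * (x \<bullet> e2)) *\<^sub>R e1
           + (sin r * (x \<bullet> e1) + (cos r - 1) * (x \<bullet> e2)) *\<^sub>R e2"
  show "linear ?f"
    by (intro linearI) (simp_all add: algebra_simps)
  \<comment> \<open>The expanded inner products agree as polynomials modulo this relation.\<close>
  have unit: "(sin r)\<^sup>2 + (cos r)\<^sup>2 = 1" by simp
  show "?f v \<bullet> ?f w = v \<bullet> w"
    by (simp add: inner_add_left inner_add_right inner_commute[of e1 w] inner_commute[of e2 w])
       (use unit in algebra)
qed

text \<open>By the addition formulas the rotation shifts the angle, so rotation invariance of the
  measure becomes translation invariance in \<open>t\<close>.\<close>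

lemma plane_rotation_apply:
  fixes e1 e2 :: "'a::euclidean_space"
  assumes "norm e1 = 1" "norm e2 = 1" "e1 \<bullet> e2 = 0"
  defines "u \<equiv> \<lambda>t. cos t *\<^sub>R e1 + sin t *\<^sub>R e2"
  shows "u t + ((cos r - 1) * (u t \<bullet> e1) - sin r * (u t \<bullet> e2)) *\<^sub>R e1
           + (sin r * (u t \<bullet> e1) + (cos r - 1) * (u t \<bullet> e2)) *\<^sub>R e2 = u (t + r)"
proof -
  have [simp]: "e1 \<bullet> e1 = 1" "e2 \<bullet> e2 = 1" "e1 \<bullet> e2 = 0" "e2 \<bullet> e1 = 0"
    using assms by (simp_all add: dot_square_norm inner_commute)
  show ?thesis
    by (simp add: u_def inner_add_left cos_add sin_add algebra_simps)
qed

section \<open>Measures of wedges on the sphere\<close>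

text \<open>One half of the set of directions giving \<open>u\<close> and \<open>v\<close> opposite
  signs. Strict inequalities keep adjacent wedges disjoint; the boundary between them is a null
  set.\<close>

definition sphere_wedge :: "'a::euclidean_space \<Rightarrow> 'a \<Rightarrow> 'a set" where
  "sphere_wedge u v = {\<beta> \<in> sphere 0 1. \<beta> \<bullet> u > 0 \<and> \<beta> \<bullet> v < 0}"

lemma measurable_id_uniform_sphere [measurable]:
  "(\<lambda>\<beta>. \<beta>) \<in> measurable uniform_sphere borel"
  by (simp add: measurable_cong_sets[OF sets_uniform_sphere refl] measurable_restrict_space1)

lemma sphere_wedge_sets [measurable]: "sphere_wedge u v \<in> sets uniform_sphere"
proof -
  have "{\<beta> \<in> space uniform_sphere. \<beta> \<bullet> u > 0 \<and> \<beta> \<bullet> v < 0} \<in> sets uniform_sphere"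
    by measurable
  then show ?thesis by (simp add: sphere_wedge_def)
qed

text \<open>Since \<open>f\<close> preserves inner products, pulling back the wedge of the images
  gives the original wedge, and \<open>f\<close> preserves the measure.\<close>

lemma measure_sphere_wedge_orthogonal:
  fixes f :: "'a::euclidean_space \<Rightarrow> 'a"
  assumes f: "orthogonal_transformation f"
  shows "measure uniform_sphere (sphere_wedge (f u) (f v)) = measure uniform_sphere (sphere_wedge u v)"
proof -
  have "linear f" using f by (rule orthogonal_transformation_linear)
  then have [measurable]: "f \<in> borel_measurable borel"
    by (intro borel_measurable_continuous_onI linear_continuous_on linear_linear[THEN iffD2])
  have fU: "f \<in> measurable uniform_sphere uniform_sphere"
    unfolding measurable_cong_sets[OF sets_uniform_sphere sets_uniform_sphere]
    by (intro measurable_restrict_space3) (auto simp: orthogonal_transformation_norm[OF f])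
  have "measure uniform_sphere (sphere_wedge (f u) (f v))
      = measure (distr uniform_sphere uniform_sphere f) (sphere_wedge (f u) (f v))"
    by (simp add: uniform_sphere_orthogonal_invariant[OF f])
  also have "\<dots> = measure uniform_sphere (f -` sphere_wedge (f u) (f v) \<inter> space uniform_sphere)"
    by (intro measure_distr fU sphere_wedge_sets)
  also have "f -` sphere_wedge (f u) (f v) \<inter> space uniform_sphere = sphere_wedge u v"
    using f by (auto simp: sphere_wedge_def orthogonal_transformation_def orthogonal_transformation_norm[OF f])
  finally show ?thesis .
qed

text \<open>Since \<open>sgn\<close> only rescales, the cone over this great subsphere lies in the
  hyperplane orthogonal to \<open>u\<close>, which has Lebesgue measure zero.\<close>

lemma AE_uniform_sphere_not_orthogonal:
  fixes u :: "'a::euclidean_space"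
  assumes "u \<noteq> 0"
  shows "AE \<beta> in uniform_sphere. \<beta> \<bullet> u \<noteq> 0"
proof -
  let ?A = "{\<beta> \<in> sphere 0 1. \<beta> \<bullet> u = 0}"
  let ?H = "{x. u \<bullet> x = 0}"
  have "{\<beta> \<in> space uniform_sphere. \<beta> \<bullet> u = 0} \<in> sets uniform_sphere"
    by measurable
  then have AU: "?A \<in> sets uniform_sphere" by simp
  then have A: "?A \<in> sets borel"
    by (auto simp: sets_uniform_sphere sets_restrict_space)
  have H: "?H \<in> sets borel"
    by (intro borel_closed closed_hyperplane)
  have "negligible ?H" using assms by (intro negligible_hyperplane) auto
  then have "?H \<in> null_sets lebesgue" by (simp add: negligible_iff_null_sets)
  then have "emeasure lborel ?H = 0"
    using H null_sets_completion_iff[of ?H lborel] by auto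
  moreover have "ball 0 1 \<inter> sgn -` ?A \<subseteq> ?H"
    by (auto simp: sgn_div_norm inner_commute split: if_splits)
  ultimately have "emeasure lborel (ball 0 1 \<inter> sgn -` ?A) = 0"
    using emeasure_mono[of "ball 0 1 \<inter> sgn -` ?A" ?H lborel] H by simp
  moreover have "?A \<subseteq> sphere 0 1" by auto
  ultimately have "emeasure uniform_sphere ?A = 0"
    by (simp only: emeasure_uniform_sphere[OF A] ennreal_zero_divide)
  then have "?A \<in> null_sets uniform_sphere"
    using AU by auto
  then show ?thesis
    by (rule AE_I') auto
qed

text \<open>Off the null set where \<open>\<beta> \<bullet> u b = 0\<close>, the sign of
  \<open>\<beta> \<bullet> u b\<close> decides which smaller wedge contains \<beta>. The bound by a
  half turn gives the converse inclusion, as \<open>u b\<close> then lies between \<open>u a\<close>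
  and \<open>u c\<close>.\<close>

lemma measure_sphere_wedge_add:
  fixes e1 e2 :: "'a::euclidean_space"
  assumes e: "norm e1 = 1" "norm e2 = 1" "e1 \<bullet> e2 = 0"
  defines "u \<equiv> \<lambda>t. cos t *\<^sub>R e1 + sin t *\<^sub>R e2"
  assumes ab: "a < b" and bc: "b < c" and ca: "c \<le> a + pi"
  shows "measure uniform_sphere (sphere_wedge (u a) (u c))
       = measure uniform_sphere (sphere_wedge (u a) (u b)) + measure uniform_sphere (sphere_wedge (u b) (u c))"
proof -
  interpret prob_space "uniform_sphere :: 'a measure" by (rule prob_space_uniform_sphere)
  have [simp]: "e1 \<bullet> e1 = 1" "e2 \<bullet> e2 = 1" "e1 \<bullet> e2 = 0" "e2 \<bullet> e1 = 0"
    using e by (simp_all add: norm_eq_1 inner_commute)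
  have "u b \<bullet> u b = 1"
    by (simp add: u_def inner_add_left inner_add_right flip: power2_eq_square)
  then have "u b \<noteq> 0" by auto
  then have ae: "AE \<beta> in uniform_sphere. \<beta> \<bullet> u b \<noteq> 0"
    by (rule AE_uniform_sphere_not_orthogonal)
  have s: "sin (b - a) > 0" "sin (c - b) > 0" "sin (c - a) \<ge> 0"
    using ab bc ca by (auto intro!: sin_gt_zero sin_ge_zero)
  \<comment> \<open>\<open>u b\<close> is a nonnegative combination of \<open>u a\<close> and \<open>u c\<close>, up to the factor \<open>sin (c - a)\<close>, which may vanish\<close>
  have comb: "sin (c - a) * (\<beta> \<bullet> u b) = sin (c - b) * (\<beta> \<bullet> u a) + sin (b - a) * (\<beta> \<bullet> u c)" for \<beta>
    by (simp add: u_def inner_add_right sin_diff algebra_simps)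
  \<comment> \<open>The left side of \<open>comb\<close> is at most 0 and its \<open>u a\<close>
    term is positive, which forces the \<open>u c\<close> term to be negative.\<close>
  have 1: "\<beta> \<bullet> u c < 0" if "\<beta> \<bullet> u a > 0" "\<beta> \<bullet> u b < 0" for \<beta>
  proof -
    have "sin (b - a) * (\<beta> \<bullet> u c) < 0"
      using comb[of \<beta>] mult_pos_pos[OF s(2) that(1)] mult_nonneg_nonpos[OF s(3), of "\<beta> \<bullet> u b"] that by linarith
    then show ?thesis using s by (simp add: mult_less_0_iff)
  qed
  have 2: "\<beta> \<bullet> u a > 0" if "\<beta> \<bullet> u b > 0" "\<beta> \<bullet> u c < 0" for \<beta>
  proof -
    have "sin (c - b) * (\<beta> \<bullet> u a) > 0"
      using comb[of \<beta>] mult_pos_neg[OF s(1) that(2)] mult_nonneg_nonneg[OF s(3), of "\<beta> \<bullet> u b"] that by linarith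
    then show ?thesis using s by (simp add: zero_less_mult_iff)
  qed
  have "AE \<beta> in uniform_sphere. \<beta> \<in> sphere_wedge (u a) (u c)
      \<longleftrightarrow> \<beta> \<in> sphere_wedge (u a) (u b) \<union> sphere_wedge (u b) (u c)"
    using ae by eventually_elim (use 1 2 in \<open>auto simp: sphere_wedge_def neq_iff\<close>)
  then have "measure uniform_sphere (sphere_wedge (u a) (u c))
      = measure uniform_sphere (sphere_wedge (u a) (u b) \<union> sphere_wedge (u b) (u c))"
    by (rule measure_eq_AE) auto
  also have "\<dots> = measure uniform_sphere (sphere_wedge (u a) (u b)) + measure uniform_sphere (sphere_wedge (u b) (u c))"
    by (rule finite_measure_Union[OF sphere_wedge_sets sphere_wedge_sets]) (auto simp: sphere_wedge_def)
  finally show ?thesis .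
qed

text \<open>The wedge is an open hemisphere. The antipodal map exchanges it with the opposite one,
  and together they cover the sphere up to a null set.\<close>

lemma measure_sphere_wedge_opposite:
  fixes u :: "'a::euclidean_space"
  assumes "u \<noteq> 0"
  shows "measure uniform_sphere (sphere_wedge u (- u)) = 1 / 2"
proof -
  interpret prob_space "uniform_sphere :: 'a measure" by (rule prob_space_uniform_sphere)
  have "orthogonal_transformation (uminus :: 'a \<Rightarrow> 'a)"
    by (auto simp: orthogonal_transformation_def intro!: linearI)
  from measure_sphere_wedge_orthogonal[OF this, of u "- u"]
  have eq: "measure uniform_sphere (sphere_wedge (- u) u) = measure uniform_sphere (sphere_wedge u (- u))"
    by simp
  have "AE \<beta> in uniform_sphere. \<beta> \<in> sphere_wedge u (- u) \<union> sphere_wedge (- u) u \<longleftrightarrow> \<beta> \<in> space uniform_sphere"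
    using AE_uniform_sphere_not_orthogonal[OF assms] AE_space
    by eventually_elim (auto simp: sphere_wedge_def)
  then have "measure uniform_sphere (sphere_wedge u (- u) \<union> sphere_wedge (- u) u)
      = measure uniform_sphere (space uniform_sphere :: 'a set)"
    by (rule measure_eq_AE) (auto simp del: space_uniform_sphere)
  also have "measure uniform_sphere (sphere_wedge u (- u) \<union> sphere_wedge (- u) u) =
     measure uniform_sphere (sphere_wedge u (- u)) + measure uniform_sphere (sphere_wedge (- u) u)"
    by (rule finite_measure_Union[OF sphere_wedge_sets sphere_wedge_sets]) (auto simp: sphere_wedge_def)
  finally show ?thesis using eq by (simp add: prob_space del: space_uniform_sphere)
qed

section \<open>Cauchy's functional equation on an interval\<close>

text \<open>Nonnegativity makes \<open>f\<close> monotone, and additivity fixes its values on the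
  grid of multiples of \<open>L / n\<close>; squeezing between grid points leaves an error of at
  most \<open>f L / n\<close>.\<close>

lemma additive_nonneg_imp_linear:
  fixes f :: "real \<Rightarrow> real"
  assumes add: "\<And>x y. 0 < x \<Longrightarrow> 0 < y \<Longrightarrow> x + y \<le> L \<Longrightarrow> f (x + y) = f x + f y"
    and nonneg: "\<And>x. 0 \<le> f x" and f0: "f 0 = 0"
    and x: "0 \<le> x" "x \<le> L" and L: "L > 0"
  shows "f x = x / L * f L"
proof -
  have mono: "f y \<le> f z" if "0 \<le> y" "y \<le> z" "z \<le> L" for y z
  proof (cases "y = 0 \<or> y = z")
    case True
    then show ?thesis using f0 nonneg by auto
  next
    case False
    then have "f (y + (z - y)) = f y + f (z - y)" using that by (intro add) auto
    then show ?thesis using nonneg[of "z - y"] by simp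
  qed
  have mult: "f (real k * y) = real k * f y" if "0 < y" "real k * y \<le> L" for k y
    using that(2)
  proof (induction k)
    case 0
    show ?case by (simp add: f0)
  next
    case (Suc k)
    then have le: "real k * y + y \<le> L" by (simp add: algebra_simps)
    have "f (real k * y + y) = f (real k * y) + f y"
    proof (cases "k = 0")
      case False
      then show ?thesis using le that by (intro add) auto
    qed (simp add: f0)
    moreover have "f (real k * y) = real k * f y" using le that by (intro Suc.IH) linarith
    ultimately show ?case by (simp add: algebra_simps)
  qed
  have bound: "\<bar>f x - x / L * f L\<bar> \<le> f L / real n" if n: "n > 0" for n
  proof -
    define y where "y = L / real n"
    have y: "y > 0" "real n * y = L" using n L by (auto simp: y_def)
    have fy: "f y = f L / real n" using mult[OF y(1), of n] y n by (simp add: field_simps)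
    \<comment> \<open>The grid cell containing \<open>x\<close> starts at \<open>k * y\<close>. Both
      \<open>f x\<close> and \<open>x / y * f y\<close> lie between \<open>k * f y\<close> and
      \<open>(k + 1) * f y\<close>, hence differ by at most \<open>f y\<close>.\<close>
    define k where "k = nat \<lfloor>x / y\<rfloor>"
    have "real k = of_int \<lfloor>x / y\<rfloor>" using x y by (simp add: k_def)
    then have k: "real k \<le> x / y" "x / y < real k + 1" by linarith+
    then have kx: "real k * y \<le> x" "x < real (Suc k) * y" using y by (simp_all add: field_simps)
    have "x / L * f L = x / (real n * y) * (real n * f y)" using y fy n by simp
    then have xL: "x / L * f L = x / y * f y" using n by simp
    have "real k * f y \<le> f x"
      using mult[OF y(1), of k] mono[of "real k * y" x] kx x y by simp
    moreover have "f x \<le> real (Suc k) * f y"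
    proof (cases "real (Suc k) * y \<le> L")
      case True
      then show ?thesis
        using mult[OF y(1), of "Suc k"] mono[of x "real (Suc k) * y"] kx x y by simp
    next
      case False
      then have "n < Suc k" using y by (metis mult_le_cancel_right_pos of_nat_le_iff not_le)
      then have "real n * f y \<le> real (Suc k) * f y" using nonneg by (intro mult_right_mono) auto
      moreover have "f x \<le> f L" using x by (intro mono) auto
      moreover have "f L = real n * f y" using fy n by simp
      ultimately show ?thesis by simp
    qed
    moreover have "real k * f y \<le> x / y * f y" by (rule mult_right_mono[OF k(1) nonneg])
    moreover have "x / y * f y \<le> (real k + 1) * f y"
      by (rule mult_right_mono[OF less_imp_le[OF k(2)] nonneg])
    ultimately show ?thesis unfolding xL fy[symmetric] by (simp add: algebra_simps abs_le_iff)
  qed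
  have "(\<lambda>n. f L / real n) \<longlonglongrightarrow> 0" by (rule lim_const_over_n)
  then have "\<bar>f x - x / L * f L\<bar> \<le> 0"
    by (rule tendsto_lowerbound) (use bound in \<open>auto simp: eventually_sequentially intro!: exI[of _ 1]\<close>)
  then show ?thesis by simp
qed

section \<open>Wedge measure as a function of the angle\<close>

lemma measure_sphere_wedge_plane:
  fixes e1 e2 :: "'a::euclidean_space"
  assumes e: "norm e1 = 1" "norm e2 = 1" "e1 \<bullet> e2 = 0"
  assumes t: "0 \<le> t" "t \<le> pi"
  shows "measure uniform_sphere (sphere_wedge e1 (cos t *\<^sub>R e1 + sin t *\<^sub>R e2)) = t / (2 * pi)"
proof -
  define u where "u = (\<lambda>t. cos t *\<^sub>R e1 + sin t *\<^sub>R e2)"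
  define f where "f t = measure uniform_sphere (sphere_wedge (u 0) (u t))" for t
  have rot: "measure uniform_sphere (sphere_wedge (u (s + r)) (u (t + r)))
      = measure uniform_sphere (sphere_wedge (u s) (u t))" for r s t
    using measure_sphere_wedge_orthogonal[OF orthogonal_transformation_plane_rotation[OF e, of r], of "u s" "u t"]
    unfolding u_def plane_rotation_apply[OF e] .
  have "f t = t / pi * f pi"
  proof (rule additive_nonneg_imp_linear[OF _ _ _ t pi_gt_zero])
    fix x y :: real assume xy: "0 < x" "0 < y" "x + y \<le> pi"
    show "f (x + y) = f x + f y"
      \<comment> \<open>Split at angle \<open>x\<close>, then rotate the second wedge back by
        \<open>x\<close> so that it starts at angle 0.\<close>
      using measure_sphere_wedge_add[OF e, of 0 x "x + y"] xy rot[of 0 x y]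
      unfolding f_def u_def by (simp add: add.commute)
  next
    have "sphere_wedge (u 0) (u 0) = {}" by (auto simp: sphere_wedge_def)
    then show "f 0 = 0" by (simp add: f_def)
  qed (simp add: f_def)
  moreover have "f pi = 1 / 2"
    using measure_sphere_wedge_opposite[of e1] e by (force simp: f_def u_def)
  ultimately have "f t = t / (2 * pi)" by (simp add: field_simps)
  then show ?thesis by (simp add: f_def u_def)
qed

lemma sphere_wedge_scaleR:
  assumes "a > 0" "b > 0"
  shows "sphere_wedge (a *\<^sub>R u) (b *\<^sub>R v) = sphere_wedge u v"
  using assms by (auto simp: sphere_wedge_def zero_less_mult_iff mult_less_0_iff)

text \<open>Only directions matter, and Gram-Schmidt writes the second unit vector as
  \<open>cos t *\<^sub>R e1 + sin t *\<^sub>R e2\<close> with \<open>t\<close> the angle. Parallel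
  vectors determine no plane and are treated separately.\<close>

lemma measure_sphere_wedge:
  fixes u v :: "'a::euclidean_space"
  assumes "u \<noteq> 0" "v \<noteq> 0"
  shows "measure uniform_sphere (sphere_wedge u v) = Ang u v / (2 * pi)"
proof -
  define e1 where "e1 = sgn u"
  define w where "w = sgn v"
  have n: "norm e1 = 1" "norm w = 1" using assms by (simp_all add: e1_def w_def norm_sgn)
  then have [simp]: "e1 \<bullet> e1 = 1" "w \<bullet> w = 1" by (simp_all add: norm_eq_1)
  define c where "c = e1 \<bullet> w"
  have c: "\<bar>c\<bar> \<le> 1" using Cauchy_Schwarz_ineq2[of e1 w] n by (simp add: c_def)
  have Ang: "Ang u v = arccos c"
    by (simp add: Ang_def c_def e1_def w_def sgn_div_norm field_simps)
  have W: "sphere_wedge u v = sphere_wedge e1 w"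
    unfolding e1_def w_def sgn_div_norm using assms by (intro sphere_wedge_scaleR[symmetric]) auto
  define z where "z = w - c *\<^sub>R e1"
  have ez: "e1 \<bullet> z = 0" by (simp add: z_def c_def inner_diff_right)
  have zz: "z \<bullet> z = 1 - c\<^sup>2"
    by (simp add: z_def c_def inner_diff_right inner_diff_left inner_commute[of w e1] power2_eq_square)
  show ?thesis
  proof (cases "z = 0")
    case True
    then have "c\<^sup>2 = 1" using zz by simp
    then consider "c = 1" | "c = - 1" by (auto simp: power2_eq_1_iff)
    then show ?thesis
    proof cases
      case 1
      then have "sphere_wedge e1 w = {}" using True by (auto simp: z_def sphere_wedge_def)
      then show ?thesis using 1 by (simp add: W Ang)
    next
      case 2
      then have "w = - e1" using True by (simp add: z_def add_eq_0_iff)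
      then show ?thesis
        using 2 measure_sphere_wedge_opposite[of e1] n by (force simp: W Ang)
    qed
  next
    case False
    define e2 where "e2 = sgn z"
    have e2: "norm e2 = 1" "e1 \<bullet> e2 = 0"
      using False ez by (auto simp: e2_def norm_sgn sgn_div_norm)
    have "norm z = sqrt (1 - c\<^sup>2)" by (simp add: norm_eq_sqrt_inner zz)
    \<comment> \<open>With this, the sine multiple of \<open>e2\<close> is exactly \<open>z\<close>,
      so the sum recovers \<open>w\<close>.\<close>
    then have "sin (arccos c) = norm z" using c by (simp add: sin_arccos abs_le_iff)
    then have "cos (arccos c) *\<^sub>R e1 + sin (arccos c) *\<^sub>R e2 = w"
      using c False by (simp add: cos_arccos_abs e2_def sgn_div_norm z_def)
    then show ?thesis
      using measure_sphere_wedge_plane[OF n(1) e2, of "arccos c"] c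
      by (simp add: W Ang arccos_lbound arccos_ubound abs_le_iff)
  qed
qed

lemma Ang_commute: "Ang u v = Ang v u"
  by (simp add: Ang_def inner_commute mult.commute)

text \<open>Almost everywhere the product of signs is 1, except on the two disjoint wedges, where it
  is -1; each wedge has measure \<open>Ang u v / (2 * pi)\<close>.\<close>

lemma integral_sgn_inner_uniform_sphere:
  fixes u v :: "'a::euclidean_space"
  assumes "u \<noteq> 0" "v \<noteq> 0"
  shows "(\<integral>\<beta>. sgn (\<beta> \<bullet> u) * sgn (\<beta> \<bullet> v) \<partial>uniform_sphere) = 1 - 2 * Ang u v / pi"
proof -
  interpret prob_space "uniform_sphere :: 'a measure" by (rule prob_space_uniform_sphere)
  have "(\<integral>\<beta>. sgn (\<beta> \<bullet> u) * sgn (\<beta> \<bullet> v) \<partial>uniform_sphere)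
      = (\<integral>\<beta>. 1 - 2 * indicator (sphere_wedge u v) \<beta> - 2 * indicator (sphere_wedge v u) \<beta> \<partial>uniform_sphere)"
  proof (rule integral_cong_AE)
    show "AE \<beta> in uniform_sphere. sgn (\<beta> \<bullet> u) * sgn (\<beta> \<bullet> v)
        = 1 - 2 * indicator (sphere_wedge u v) \<beta> - 2 * indicator (sphere_wedge v u) \<beta>"
      using AE_uniform_sphere_not_orthogonal[OF assms(1)] AE_uniform_sphere_not_orthogonal[OF assms(2)] AE_space
      by eventually_elim (auto simp: sphere_wedge_def indicator_def sgn_if)
  qed measurable
  also have "\<dots> = 1 - 2 * measure uniform_sphere (sphere_wedge u v) - 2 * measure uniform_sphere (sphere_wedge v u)"
    using prob_space by (simp add: less_top[symmetric] del: space_uniform_sphere)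
  also have "\<dots> = 1 - 2 * Ang u v / pi"
    using assms by (simp add: measure_sphere_wedge Ang_commute[of v u])
  finally show ?thesis .
qed

section \<open>Independence and measurability\<close>

text \<open>The joint law is a product, and each section of the diagonal at fixed \<open>y\<close>
  is a single point, null because a continuous distribution function has no atoms.\<close>

lemma (in prob_space) AE_indep_var_neq:
  fixes X Y :: "'a \<Rightarrow> real"
  assumes indep: "indep_var borel X borel Y"
    and cont: "continuous_on UNIV (cdf (distr M borel X))"
  shows "AE \<omega> in M. X \<omega> \<noteq> Y \<omega>"
proof -
  have [measurable]: "random_variable borel X" "random_variable borel Y"
    using indep by (auto dest: indep_var_rv1 indep_var_rv2)
  interpret X: real_distribution "distr M borel X" by (rule real_distribution_distr) simp
  interpret Y: real_distribution "distr M borel Y" by (rule real_distribution_distr) simp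
  interpret XY: pair_prob_space "distr M borel X" "distr M borel Y" ..
  have "AE x in distr M borel X. x \<noteq> y" for y
  proof -
    have "measure (distr M borel X) {y} = 0"
      using cont by (simp add: X.isCont_cdf[symmetric] continuous_on_eq_continuous_at)
    then have "{y} \<in> null_sets (distr M borel X)"
      by (auto simp: X.emeasure_eq_measure)
    then show ?thesis by (rule AE_I') auto
  qed
  then have "AE y in distr M borel Y. AE x in distr M borel X. x \<noteq> y" by simp
  moreover have off_diag: "{z \<in> space (distr M borel X \<Otimes>\<^sub>M distr M borel Y). fst z \<noteq> snd z}
      \<in> sets (distr M borel X \<Otimes>\<^sub>M distr M borel Y)"
    by measurable
  ultimately have "AE x in distr M borel X. AE y in distr M borel Y. x \<noteq> y"
    by (simp only: XY.AE_commute[OF off_diag])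
  with off_diag have "AE z in distr M borel X \<Otimes>\<^sub>M distr M borel Y. fst z \<noteq> snd z"
    by (intro XY.AE_pair_measure) simp_all
  then have "AE z in distr M (borel \<Otimes>\<^sub>M borel) (\<lambda>\<omega>. (X \<omega>, Y \<omega>)). fst z \<noteq> snd z"
    unfolding indep[unfolded indep_var_distribution_eq, THEN conjunct2, THEN conjunct2] .
  then show ?thesis
    by (subst (asm) AE_distr_iff) auto
qed

section \<open>Regrouping independent variables\<close>

lemma (in pair_prob_space) integral_bounded_mult:
  fixes f g :: "_ \<Rightarrow> real"
  assumes [measurable]: "f \<in> borel_measurable M1" "g \<in> borel_measurable M2"
    and f: "\<And>x. \<bar>f x\<bar> \<le> B" and g: "\<And>y. \<bar>g y\<bar> \<le> C"
  shows "(\<integral>z. f (fst z) * g (snd z) \<partial>(M1 \<Otimes>\<^sub>M M2)) = (\<integral>x. f x \<partial>M1) * (\<integral>y. g y \<partial>M2)"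
proof -
  have "0 \<le> B" using order_trans[OF abs_ge_zero f] .
  then have "integrable (M1 \<Otimes>\<^sub>M M2) (\<lambda>z. f (fst z) * g (snd z))"
    by (intro P.integrable_const_bound[where B = "B * C"]) (auto simp: abs_mult intro!: mult_mono f g)
  from integral_fst'[OF this] show ?thesis by simp
qed

text \<open>The hypotheses group the variables as \<open>(X1, X2)\<close> and
  \<open>(Y1, Y2)\<close>, whereas the factors group them by index. The joint law is a fourfold
  product, so integrating out the \<open>Y\<close> variables leaves
  \<open>G (X1 \<omega>) * H (X2 \<omega>)\<close>, which factors in turn.\<close>

lemma (in prob_space) expectation_mult_indep_pairs:
  fixes g h :: "'b \<times> 'b \<Rightarrow> real"
  assumes X: "indep_var S X1 S X2" and Y: "indep_var T Y1 T Y2"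
    and XY: "indep_var (S \<Otimes>\<^sub>M S) (\<lambda>\<omega>. (X1 \<omega>, X2 \<omega>)) (T \<Otimes>\<^sub>M T) (\<lambda>\<omega>. (Y1 \<omega>, Y2 \<omega>))"
    and [measurable]: "g \<in> borel_measurable (S \<Otimes>\<^sub>M T)" "h \<in> borel_measurable (S \<Otimes>\<^sub>M T)"
    and g: "\<And>z. \<bar>g z\<bar> \<le> B" and h: "\<And>z. \<bar>h z\<bar> \<le> C"
  shows "expectation (\<lambda>\<omega>. g (X1 \<omega>, Y1 \<omega>) * h (X2 \<omega>, Y2 \<omega>))
       = expectation (\<lambda>\<omega>. g (X1 \<omega>, Y1 \<omega>)) * expectation (\<lambda>\<omega>. h (X2 \<omega>, Y2 \<omega>))"
proof -
  have [measurable]: "random_variable S X1" "random_variable S X2" "random_variable T Y1" "random_variable T Y2"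
    using X Y by (auto dest: indep_var_rv1 indep_var_rv2)
  let ?X1 = "distr M S X1" and ?X2 = "distr M S X2" and ?Y1 = "distr M T Y1" and ?Y2 = "distr M T Y2"
  interpret X1: prob_space ?X1 by (rule prob_space_distr) simp
  interpret X2: prob_space ?X2 by (rule prob_space_distr) simp
  interpret Y1: prob_space ?Y1 by (rule prob_space_distr) simp
  interpret Y2: prob_space ?Y2 by (rule prob_space_distr) simp
  interpret X: pair_prob_space ?X1 ?X2 ..
  interpret Y: pair_prob_space ?Y1 ?Y2 ..
  interpret X1Y1: pair_prob_space ?X1 ?Y1 ..
  interpret X2Y2: pair_prob_space ?X2 ?Y2 ..
  interpret XY: pair_prob_space "?X1 \<Otimes>\<^sub>M ?X2" "?Y1 \<Otimes>\<^sub>M ?Y2" ..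
  have B: "0 \<le> B" and C: "0 \<le> C"
    using order_trans[OF abs_ge_zero g] order_trans[OF abs_ge_zero h] by auto
  define G where "G x = (\<integral>y. g (x, y) \<partial>?Y1)" for x
  define H where "H x = (\<integral>y. h (x, y) \<partial>?Y2)" for x
  have [measurable]: "G \<in> borel_measurable S" "H \<in> borel_measurable S"
    unfolding G_def H_def by measurable
  \<comment> \<open>The bound is claimed for every \<open>x\<close>, even outside
    \<open>space S\<close>; a non-integrable section has integral 0 by convention.\<close>
  have GB: "\<bar>G x\<bar> \<le> B" for x
  proof (cases "integrable ?Y1 (\<lambda>y. g (x, y))")
    case True
    then show ?thesis
      unfolding G_def by (intro order_trans[OF integral_abs_bound] Y1.integral_le_const) (auto simp: g)
  qed (simp add: G_def not_integrable_integral_eq B)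
  have HC: "\<bar>H x\<bar> \<le> C" for x
  proof (cases "integrable ?Y2 (\<lambda>y. h (x, y))")
    case True
    then show ?thesis
      unfolding H_def by (intro order_trans[OF integral_abs_bound] Y2.integral_le_const) (auto simp: h)
  qed (simp add: H_def not_integrable_integral_eq C)
  have joint: "distr M ((S \<Otimes>\<^sub>M S) \<Otimes>\<^sub>M (T \<Otimes>\<^sub>M T)) (\<lambda>\<omega>. ((X1 \<omega>, X2 \<omega>), (Y1 \<omega>, Y2 \<omega>)))
      = (?X1 \<Otimes>\<^sub>M ?X2) \<Otimes>\<^sub>M (?Y1 \<Otimes>\<^sub>M ?Y2)"
    using X Y XY by (simp add: indep_var_distribution_eq)
  have j1: "distr M (S \<Otimes>\<^sub>M T) (\<lambda>\<omega>. (X1 \<omega>, Y1 \<omega>)) = ?X1 \<Otimes>\<^sub>M ?Y1"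
    using indep_var_compose[OF XY measurable_fst measurable_fst]
    by (simp add: indep_var_distribution_eq comp_def)
  have j2: "distr M (S \<Otimes>\<^sub>M T) (\<lambda>\<omega>. (X2 \<omega>, Y2 \<omega>)) = ?X2 \<Otimes>\<^sub>M ?Y2"
    using indep_var_compose[OF XY measurable_snd measurable_snd]
    by (simp add: indep_var_distribution_eq comp_def)
  have int1: "expectation (\<lambda>\<omega>. g (X1 \<omega>, Y1 \<omega>)) = (\<integral>x. G x \<partial>?X1)"
  proof -
    have "integrable (?X1 \<Otimes>\<^sub>M ?Y1) g"
      by (intro X1Y1.P.integrable_const_bound[where B = B]) (auto simp: g)
    from X1Y1.integral_fst'[OF this] show ?thesis
      by (simp add: j1[symmetric] integral_distr G_def)
  qed
  have int2: "expectation (\<lambda>\<omega>. h (X2 \<omega>, Y2 \<omega>)) = (\<integral>x. H x \<partial>?X2)"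
  proof -
    have "integrable (?X2 \<Otimes>\<^sub>M ?Y2) h"
      by (intro X2Y2.P.integrable_const_bound[where B = C]) (auto simp: h)
    from X2Y2.integral_fst'[OF this] show ?thesis
      by (simp add: j2[symmetric] integral_distr H_def)
  qed
  let ?f = "\<lambda>z. g (fst (fst z), fst (snd z)) * h (snd (fst z), snd (snd z))"
  have "expectation (\<lambda>\<omega>. g (X1 \<omega>, Y1 \<omega>) * h (X2 \<omega>, Y2 \<omega>))
      = (\<integral>z. ?f z \<partial>((?X1 \<Otimes>\<^sub>M ?X2) \<Otimes>\<^sub>M (?Y1 \<Otimes>\<^sub>M ?Y2)))"
    by (simp add: joint[symmetric] integral_distr)
  also have "\<dots> = (\<integral>x. (\<integral>y. ?f (x, y) \<partial>(?Y1 \<Otimes>\<^sub>M ?Y2)) \<partial>(?X1 \<Otimes>\<^sub>M ?X2))"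
    by (intro XY.integral_fst'[symmetric] XY.P.integrable_const_bound[where B = "B * C"])
       (auto simp: abs_mult intro!: mult_mono g h B)
  also have "\<dots> = (\<integral>x. G (fst x) * H (snd x) \<partial>(?X1 \<Otimes>\<^sub>M ?X2))"
  proof (rule Bochner_Integration.integral_cong)
    fix x assume "x \<in> space (?X1 \<Otimes>\<^sub>M ?X2)"
    then have [measurable]: "fst x \<in> space S" "snd x \<in> space S" by (auto simp: space_pair_measure)
    show "(\<integral>y. ?f (x, y) \<partial>(?Y1 \<Otimes>\<^sub>M ?Y2)) = G (fst x) * H (snd x)"
      using Y.integral_bounded_mult[of "\<lambda>y. g (fst x, y)" "\<lambda>y. h (snd x, y)" B C] g h
      by (simp add: G_def H_def)
  qed simp
  also have "\<dots> = (\<integral>x. G x \<partial>?X1) * (\<integral>x. H x \<partial>?X2)"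
    by (rule X.integral_bounded_mult) (auto intro: GB HC)
  finally show ?thesis by (simp add: int1 int2)
qed

section \<open>Bounds and measurability of the angle; coinciding points\<close>

text \<open>Cauchy-Schwarz; zero vectors are covered because the quotient is then 0.\<close>

lemma inner_norm_quotient_bounds:
  fixes u v :: "'a::real_inner"
  shows "- 1 \<le> (u \<bullet> v) / (norm u * norm v)" "(u \<bullet> v) / (norm u * norm v) \<le> 1"
proof -
  have "\<bar>(u \<bullet> v) / (norm u * norm v)\<bar> \<le> 1"
    using Cauchy_Schwarz_ineq2[of u v] by (auto simp: abs_mult divide_le_eq_1)
  then show "- 1 \<le> (u \<bullet> v) / (norm u * norm v)" "(u \<bullet> v) / (norm u * norm v) \<le> 1"
    by linarith+
qed

lemma Ang_bounds: "0 \<le> Ang u v" "Ang u v \<le> pi"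
  using inner_norm_quotient_bounds[of u v] by (simp_all add: Ang_def arccos_lbound arccos_ubound)

lemma borel_measurable_Ang [measurable (raw)]:
  fixes f g :: "'b \<Rightarrow> 'a::euclidean_space"
  assumes [measurable]: "f \<in> borel_measurable M" "g \<in> borel_measurable M"
  shows "(\<lambda>x. Ang (f x) (g x)) \<in> borel_measurable M"
proof -
  \<comment> \<open>Continuity of \<open>arccos\<close> is available on \<open>[-1, 1]\<close>;
    clamping extends it to the line without changing the values taken here.\<close>
  have "(\<lambda>r::real. arccos (max (- 1) (min 1 r))) \<in> borel_measurable borel"
    by (intro borel_measurable_continuous_onI continuous_on_arccos continuous_intros) auto
  then have "(\<lambda>x. arccos (max (- 1) (min 1 ((f x \<bullet> g x) / (norm (f x) * norm (g x)))))) \<in> borel_measurable M"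
    by measurable
  then show ?thesis
    unfolding Ang_def by (simp add: inner_norm_quotient_bounds max_absorb2 min_absorb2)
qed

text \<open>If \<open>X \<omega> = Y \<omega>\<close>, the inequality fails at \<open>\<omega>\<close> for every \<open>\<beta>\<close>.\<close>
lemma (in prob_space) AE_diff_neq_0:
  fixes X Y :: "'a \<Rightarrow> 'b::euclidean_space"
  assumes [measurable]: "X \<in> borel_measurable M" "Y \<in> borel_measurable M"
    and ae: "AE \<beta> in uniform_sphere. AE \<omega> in M. \<beta> \<bullet> X \<omega> \<noteq> \<beta> \<bullet> Y \<omega>"
  shows "AE \<omega> in M. X \<omega> - Y \<omega> \<noteq> 0"
proof -
  interpret S: prob_space "uniform_sphere :: 'b measure" by (rule prob_space_uniform_sphere)
  interpret pair_prob_space "uniform_sphere :: 'b measure" M ..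
  have [measurable]: "fst \<in> borel_measurable (uniform_sphere \<Otimes>\<^sub>M M)"
    by (rule measurable_compose[OF measurable_fst measurable_id_uniform_sphere])
  \<comment> \<open>Fubini for null sets exchanges the two quantifiers, so that \<omega> can be
    fixed first.\<close>
  have "AE \<omega> in M. AE \<beta> in uniform_sphere. \<beta> \<bullet> X \<omega> \<noteq> \<beta> \<bullet> Y \<omega>"
    using ae by (subst (asm) AE_commute) auto
  then show ?thesis
  proof eventually_elim
    case (elim \<omega>)
    then show ?case by (cases "X \<omega> = Y \<omega>") auto
  qed
qed

section \<open>Averaging over directions and exchanging the integrals\<close>

theorem proposition7p2:
  fixes M :: "'w measure"
    and X1 X2 Y1 Y2 :: "'w \<Rightarrow> real ^ 'd"
    and P\<^sub>X P\<^sub>Y :: "(real ^ 'd) measure"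
  assumes "prob_space M"
    and "prob_space.indep_var M borel X1 borel X2"
    and "prob_space.indep_var M borel Y1 borel Y2"
    and "prob_space.indep_var M (borel \<Otimes>\<^sub>M borel) (\<lambda>\<omega>. (X1 \<omega>, X2 \<omega>))
                                (borel \<Otimes>\<^sub>M borel) (\<lambda>\<omega>. (Y1 \<omega>, Y2 \<omega>))"
    and "distr M borel X1 = P\<^sub>X" and "distr M borel X2 = P\<^sub>X"
    and "distr M borel Y1 = P\<^sub>Y" and "distr M borel Y2 = P\<^sub>Y"
    and "AE \<beta> in uniform_sphere. continuous_on UNIV (cdf (distr M borel (\<lambda>\<omega>. \<beta> \<bullet> X1 \<omega>)))"
    and "AE \<beta> in uniform_sphere. continuous_on UNIV (cdf (distr M borel (\<lambda>\<omega>. \<beta> \<bullet> Y1 \<omega>)))"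
  shows "(\<integral>\<beta>. (\<P>(\<omega> in M. \<beta> \<bullet> X1 \<omega> > \<beta> \<bullet> Y1 \<omega>) - 1 / 2)\<^sup>2 \<partial>uniform_sphere)
       = 1 / 4 - 1 / (2 * pi) * (\<integral>\<omega>. Ang (X1 \<omega> - Y1 \<omega>) (X2 \<omega> - Y2 \<omega>) \<partial>M)"
proof -
  interpret prob_space M by fact
  let ?U = "uniform_sphere :: (real ^ 'd) measure"
  interpret U: prob_space ?U by (rule prob_space_uniform_sphere)
  interpret UM: pair_prob_space ?U M ..
  have [measurable]: "X1 \<in> borel_measurable M" "X2 \<in> borel_measurable M"
    "Y1 \<in> borel_measurable M" "Y2 \<in> borel_measurable M"
    using assms(2,3) by (auto dest: indep_var_rv1 indep_var_rv2)
  have [measurable]: "fst \<in> borel_measurable (?U \<Otimes>\<^sub>M M)"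
    by (rule measurable_compose[OF measurable_fst measurable_id_uniform_sphere])
  have pairs: "indep_var borel X1 borel Y1" "indep_var borel X2 borel Y2"
    using indep_var_compose[OF assms(4) measurable_fst measurable_fst]
      indep_var_compose[OF assms(4) measurable_snd measurable_snd] by (simp_all add: comp_def)
  have same: "distr M (borel \<Otimes>\<^sub>M borel) (\<lambda>\<omega>. (X1 \<omega>, Y1 \<omega>)) = distr M (borel \<Otimes>\<^sub>M borel) (\<lambda>\<omega>. (X2 \<omega>, Y2 \<omega>))"
    using pairs[unfolded indep_var_distribution_eq] assms(5-8) by simp
  have "AE \<omega> in M. \<beta> \<bullet> X \<omega> \<noteq> \<beta> \<bullet> Y \<omega>"
    if "indep_var borel X borel Y" "continuous_on UNIV (cdf (distr M borel (\<lambda>\<omega>. \<beta> \<bullet> X \<omega>)))"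
    for X Y :: "'w \<Rightarrow> real ^ 'd" and \<beta>
    using AE_indep_var_neq[of "\<lambda>\<omega>. \<beta> \<bullet> X \<omega>" "\<lambda>\<omega>. \<beta> \<bullet> Y \<omega>"] that
      indep_var_compose[OF that(1), of "\<lambda>x. \<beta> \<bullet> x" borel "\<lambda>x. \<beta> \<bullet> x" borel]
    by (simp add: comp_def)
  note neq = this
  have ae1: "AE \<beta> in ?U. AE \<omega> in M. \<beta> \<bullet> X1 \<omega> \<noteq> \<beta> \<bullet> Y1 \<omega>"
    using assms(9) by eventually_elim (rule neq[OF pairs(1)])
  \<comment> \<open>Equality in law carries the continuity assumption from \<open>X1\<close> to
    \<open>X2\<close>.\<close>
  have "distr M borel (\<lambda>\<omega>. \<beta> \<bullet> X2 \<omega>) = distr M borel (\<lambda>\<omega>. \<beta> \<bullet> X1 \<omega>)" for \<beta>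
    using distr_distr[of "\<lambda>x. \<beta> \<bullet> x" borel borel X1 M] distr_distr[of "\<lambda>x. \<beta> \<bullet> x" borel borel X2 M] assms(5,6)
    by (simp add: comp_def)
  then have ae2: "AE \<beta> in ?U. AE \<omega> in M. \<beta> \<bullet> X2 \<omega> \<noteq> \<beta> \<bullet> Y2 \<omega>"
    using assms(9) by (auto elim!: eventually_mono intro!: neq[OF pairs(2)])
  have nz: "AE \<omega> in M. X1 \<omega> - Y1 \<omega> \<noteq> 0" "AE \<omega> in M. X2 \<omega> - Y2 \<omega> \<noteq> 0"
    by (rule AE_diff_neq_0[OF _ _ ae1] AE_diff_neq_0[OF _ _ ae2]; simp)+
  let ?s = "\<lambda>\<beta> \<omega>. sgn (\<beta> \<bullet> (X1 \<omega> - Y1 \<omega>)) * sgn (\<beta> \<bullet> (X2 \<omega> - Y2 \<omega>))"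
  have sgn_le: "\<bar>sgn r\<bar> \<le> 1" for r :: real by (simp add: sgn_if)
  \<comment> \<open>As an integral over \<omega> the probability is measurable in \<beta> and its
    integrand can be compared with a sign pointwise.\<close>
  have prob_eq: "\<P>(\<omega> in M. \<beta> \<bullet> X1 \<omega> > \<beta> \<bullet> Y1 \<omega>) - 1 / 2
      = (\<integral>\<omega>. of_bool (\<beta> \<bullet> X1 \<omega> > \<beta> \<bullet> Y1 \<omega>) - 1 / 2 \<partial>M)" for \<beta>
  proof -
    have "(\<integral>\<omega>. of_bool (\<beta> \<bullet> X1 \<omega> > \<beta> \<bullet> Y1 \<omega>) - 1 / 2 \<partial>M)
        = (\<integral>\<omega>. indicator {\<omega> \<in> space M. \<beta> \<bullet> X1 \<omega> > \<beta> \<bullet> Y1 \<omega>} \<omega> - 1 / 2 \<partial>M)"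
      by (intro Bochner_Integration.integral_cong) (auto simp: indicator_def)
    also have "\<dots> = \<P>(\<omega> in M. \<beta> \<bullet> X1 \<omega> > \<beta> \<bullet> Y1 \<omega>) - 1 / 2"
      by (simp add: prob_space less_top[symmetric])
    finally show ?thesis by simp
  qed
  have "(\<integral>\<beta>. (\<P>(\<omega> in M. \<beta> \<bullet> X1 \<omega> > \<beta> \<bullet> Y1 \<omega>) - 1 / 2)\<^sup>2 \<partial>?U) = (\<integral>\<beta>. 1 / 4 * (\<integral>\<omega>. ?s \<beta> \<omega> \<partial>M) \<partial>?U)"
    unfolding prob_eq
  proof (rule integral_cong_AE)
    show "AE \<beta> in ?U. (\<integral>\<omega>. of_bool (\<beta> \<bullet> X1 \<omega> > \<beta> \<bullet> Y1 \<omega>) - 1 / 2 \<partial>M)\<^sup>2 = 1 / 4 * (\<integral>\<omega>. ?s \<beta> \<omega> \<partial>M)"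
      using ae1
    proof eventually_elim
      case (elim \<beta>)
      define h where "h z = sgn (\<beta> \<bullet> (fst z - snd z))" for z
      have h [measurable]: "h \<in> borel_measurable (borel \<Otimes>\<^sub>M borel)"
        unfolding h_def by measurable
      \<comment> \<open>Away from ties, excluded almost surely by \<open>elim\<close>, the centred
        indicator is half a sign.\<close>
      have "(\<integral>\<omega>. of_bool (\<beta> \<bullet> X1 \<omega> > \<beta> \<bullet> Y1 \<omega>) - 1 / 2 \<partial>M) = (\<integral>\<omega>. 1 / 2 * h (X1 \<omega>, Y1 \<omega>) \<partial>M)"
        using elim
        by (intro integral_cong_AE) (auto elim!: eventually_mono simp: h_def inner_diff_right sgn_if)
      also have "\<dots> = 1 / 2 * expectation (\<lambda>\<omega>. h (X1 \<omega>, Y1 \<omega>))" by simp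
      finally have 1: "(\<integral>\<omega>. of_bool (\<beta> \<bullet> X1 \<omega> > \<beta> \<bullet> Y1 \<omega>) - 1 / 2 \<partial>M)
          = 1 / 2 * expectation (\<lambda>\<omega>. h (X1 \<omega>, Y1 \<omega>))" .
      \<comment> \<open>The two index pairs have the same law, so the square is a product of
        expectations over different indices, which independence merges into one.\<close>
      have "expectation (\<lambda>\<omega>. h (X1 \<omega>, Y1 \<omega>)) = (\<integral>z. h z \<partial>distr M (borel \<Otimes>\<^sub>M borel) (\<lambda>\<omega>. (X1 \<omega>, Y1 \<omega>)))"
        by (subst integral_distr) auto
      also have "\<dots> = expectation (\<lambda>\<omega>. h (X2 \<omega>, Y2 \<omega>))"
        unfolding same by (subst integral_distr) auto
      finally have 2: "expectation (\<lambda>\<omega>. h (X1 \<omega>, Y1 \<omega>)) = expectation (\<lambda>\<omega>. h (X2 \<omega>, Y2 \<omega>))" .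
      have "\<bar>h z\<bar> \<le> 1" for z by (simp add: h_def sgn_le)
      from expectation_mult_indep_pairs[OF assms(2-4) h h this this] 2
      have "(\<integral>\<omega>. ?s \<beta> \<omega> \<partial>M) = (expectation (\<lambda>\<omega>. h (X1 \<omega>, Y1 \<omega>)))\<^sup>2"
        by (simp add: h_def power2_eq_square)
      then show ?case unfolding 1 by (simp add: power2_eq_square)
    qed
  qed measurable
  also have "\<dots> = 1 / 4 * (\<integral>\<beta>. (\<integral>\<omega>. ?s \<beta> \<omega> \<partial>M) \<partial>?U)" by simp
  also have "(\<integral>\<beta>. (\<integral>\<omega>. ?s \<beta> \<omega> \<partial>M) \<partial>?U) = (\<integral>\<omega>. (\<integral>\<beta>. ?s \<beta> \<omega> \<partial>?U) \<partial>M)"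
    by (intro UM.Fubini_integral[symmetric] UM.P.integrable_const_bound[where B = 1])
       (auto simp: abs_mult case_prod_beta intro!: mult_le_one sgn_le)
  also have "\<dots> = (\<integral>\<omega>. 1 - 2 / pi * Ang (X1 \<omega> - Y1 \<omega>) (X2 \<omega> - Y2 \<omega>) \<partial>M)"
  proof (rule integral_cong_AE)
    show "AE \<omega> in M. (\<integral>\<beta>. ?s \<beta> \<omega> \<partial>?U) = 1 - 2 / pi * Ang (X1 \<omega> - Y1 \<omega>) (X2 \<omega> - Y2 \<omega>)"
      \<comment> \<open>Grothendieck's identity at fixed \<omega>; \<open>nz\<close> supplies the
        nonzero vectors it requires.\<close>
      using nz by eventually_elim (simp add: integral_sgn_inner_uniform_sphere)
  qed measurable
  also have "\<dots> = 1 - 2 / pi * (\<integral>\<omega>. Ang (X1 \<omega> - Y1 \<omega>) (X2 \<omega> - Y2 \<omega>) \<partial>M)"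
  proof -
    have "integrable M (\<lambda>\<omega>. Ang (X1 \<omega> - Y1 \<omega>) (X2 \<omega> - Y2 \<omega>))"
      by (intro integrable_const_bound[where B = pi]) (auto simp: Ang_bounds)
    then show ?thesis by (simp add: prob_space)
  qed
  finally show ?thesis by (simp add: field_simps)
qed

end
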